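(* Let $A=(\mathbb{K}\langle\underline x\rangle,S,I,\prec)$ be a PBW-reduction-algebra over a field $\mathbb{K}$ and $M\subseteq A$ a two-sided ideal. Let $G$ be a left Gröbner basis of $M$ with respect to $\prec$. Then $A/M$ is canonically isomorphic to the PBW-reduction-algebra $$\mathbb{K}\langle\underline x\rangle/\langle S\cup I\cup\tau_{A,\prec}(G)\rangle=(\mathbb{K}\langle\underline x\rangle,S,I\cup\tau_{A,\prec}(G),\prec);$$ in particular $(\mathbb{K}\langle\underline x\rangle,S,I\cup\tau_{A,\prec}(G),\prec)$ is a PBW-reduction datum.
   Context: $\mathbb{K}\langle\underline x\rangle=\mathbb{K}\langle x_1,\dots,x_n\rangle$ is the free associative algebra; $\mathbb{K}[\underline x]$ is viewed as its $\mathbb{K}$-subspace spanned by the standard monomials $\underline x^\alpha=x_1^{\alpha_1}\cdots x_n^{\alpha_n}$, $\alpha\in\mathbb{N}^n$. A monomial ordering on standard monomials is a total order with $\underline x^\alpha\prec\underline x^{\beta}\Rightarrow\underline x^{\alpha+\gamma}\prec\underline x^{\beta+\gamma}$; it is a well-ordering if $1\preceq\underline x^\alpha$ always. $\operatorname{lm}(p)$, $\operatorname{le}(p)$ denote leading monomial and its exponent for $0\ne p\in\mathbb{K}[\underline x]$; by convention $\operatorname{le}(0)$ is smaller than all other exponents and $\alpha+\operatorname{le}(0)=\operatorname{le}(0)$. A commutation system $(S,\prec)$ consists of a monomial ordering $\prec$ and a set $S=\{x_jx_i-c_{ij}x_ix_j-d_{ij}\mid 1\le i<j\le n\}$ with $c_{ij}\in\mathbb{K}^*$,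 $d_{ij}\in\mathbb{K}[\underline x]$, $d_{ij}=0$ or $\operatorname{lm}(d_{ij})\prec x_ix_j$, such that every element of $\mathbb{K}\langle\underline x\rangle$ can be transformed into an element of $\mathbb{K}[\underline x]$ by finitely many $\mathbb{K}$-linear reductions, each replacing one monomial $m\,x_jx_i\,m'$ by $m(c_{ij}x_ix_j+d_{ij})m'$. For $G\subseteq\mathbb{K}[\underline x]$ put $\operatorname{l}_\prec(G)=\{\operatorname{le}(g)\mid 0\ne g\in G\}$, $\operatorname{L}_\prec(G)=\operatorname{l}_\prec(G)+\mathbb{N}^n$. A PBW-reduction datum $(\mathbb{K}\langle\underline x\rangle,S,I,\prec)$ is a commutation system $(S,\prec)$ with $\prec$ a well-ordering together with a finite set $I\subseteq\mathbb{K}[\underline x]$ such that $\operatorname{L}_\prec(I)=\operatorname{l}_\prec(\langle I\cup S\rangle\cap\mathbb{K}[\underline x])$ ($\langle\cdot\rangle$ the two-sided ideal). The associated PBW-reduction-algebra is $\mathbb{K}\langle\underline x\rangle/\langle I\cup S\rangle$, also denoted by the datum. Every $a\in A$ has a unique representative $\tau_{A,\prec}(a)\in\mathbb{K}[\underline x]$ which is a $\mathbb{K}$-linear combination of standard monomials $\underline x^\alpha$ with $\alpha\notin\operatorname{L}_\prec(I)$; $\operatorname{le}(a):=\operatorname{le}(\tau_{A,\prec}(a))$. A finite subset $G$ of a left ideal $M\subseteq A$ is a (left) Gröbner basis of $M$ if every $m\in M$ can be written as $m=\sum_{g\in G}a_gg$ with $a_g\in A$ and $\operatorname{le}(a_g)+\operatorname{le}(g)\preceq\operatorname{le}(m)$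 for all $g\in G$ (no condition when $a_g=0$ or $g=0$). *)

theory Defs
  imports
    "HOL-Algebra.Algebraic_Closure_Type"
    "HOL-Algebra.QuotRing"
    "HOL-Library.Poly_Mapping"
begin

section \<open>The free associative algebra\<close>

text \<open>The variables are indexed by a finite linearly ordered type \<open>'n\<close>, so \<open>n = CARD('n)\<close>.
  Words in the variables form a monoid written additively, since the convolution product on
  finitely supported functions is set up for additive monoids.  Words get a type of their own so
  that no instance is put on the list type.\<close>

datatype 'n word = Word (letters: "'n list")

instantiation word :: (type) monoid_add
begin

definition zero_word :: "'a word"
  where "0 = Word []"

definition plus_word :: "'a word \<Rightarrow> 'a word \<Rightarrow> 'a word"
  where "v + w = Word (letters v @ letters w)"

instance
  by standard (simp_all add: zero_word_def plus_word_def)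

end

type_synonym ('n, 'k) free_alg = "'n word \<Rightarrow>\<^sub>0 'k"

type_synonym 'n expo = "'n \<Rightarrow>\<^sub>0 nat"

abbreviation free_ring :: "('n, 'k::field) free_alg ring"
  where "free_ring \<equiv> ring_of_type_algebra"

lemma ring_free_ring: "ring (free_ring :: ('n, 'k::field) free_alg ring)"
proof -
  have "\<exists>y. x + y = 0" for x :: "('n, 'k) free_alg"
    using add.right_inverse by blast
  then show ?thesis
    unfolding ring_of_type_algebra_def
    by unfold_locales (auto simp: algebra_simps Units_def)
qed

definition mon :: "'n word \<Rightarrow> ('n, 'k::field) free_alg"
  where "mon w = Poly_Mapping.single w 1"

definition var :: "'n \<Rightarrow> ('n, 'k::field) free_alg"
  where "var i = mon (Word [i])"

definition scalar :: "'k::field \<Rightarrow> ('n, 'k) free_alg"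
  where "scalar c = Poly_Mapping.single 0 c"


section \<open>Standard monomials and monomial orderings\<close>

definition std_word :: "'n::{finite,linorder} expo \<Rightarrow> 'n word"
  where "std_word \<alpha> =
    Word (concat (map (\<lambda>i. replicate (Poly_Mapping.lookup \<alpha> i) i) (sorted_list_of_set UNIV)))"

text \<open>The subspace \<open>K[x]\<close> of the free algebra spanned by the standard monomials.\<close>

definition std_polys :: "('n::{finite,linorder}, 'k::field) free_alg set"
  where "std_polys = {p. Poly_Mapping.keys p \<subseteq> range std_word}"

text \<open>An ordering of the standard monomials is given by its strict part \<open>prec\<close> on exponents; it is
  unrelated to the order on exponents that the library provides.\<close>

definition preceq :: "('e \<Rightarrow> 'e \<Rightarrow> bool) \<Rightarrow> 'e \<Rightarrow> 'e \<Rightarrow> bool"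
  where "preceq prec \<alpha> \<beta> \<longleftrightarrow> prec \<alpha> \<beta> \<or> \<alpha> = \<beta>"

definition monomial_ordering :: "('n expo \<Rightarrow> 'n expo \<Rightarrow> bool) \<Rightarrow> bool"
  where "monomial_ordering prec \<longleftrightarrow>
    irreflp prec \<and> transp prec \<and> totalp prec \<and>
    (\<forall>\<alpha> \<beta> \<gamma>. prec \<alpha> \<beta> \<longrightarrow> prec (\<alpha> + \<gamma>) (\<beta> + \<gamma>))"

definition well_ordering :: "('n expo \<Rightarrow> 'n expo \<Rightarrow> bool) \<Rightarrow> bool"
  where "well_ordering prec \<longleftrightarrow> (\<forall>\<alpha>. preceq prec 0 \<alpha>)"

text \<open>The leading exponent of a nonzero element of \<open>std_polys\<close>.\<close>

definition lexp ::
  "('n expo \<Rightarrow> 'n expo \<Rightarrow> bool) \<Rightarrow> ('n::{finite,linorder}, 'k::field) free_alg \<Rightarrow> 'n expo"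
  where "lexp prec p = (THE \<alpha>. std_word \<alpha> \<in> Poly_Mapping.keys p \<and>
    (\<forall>\<beta>. std_word \<beta> \<in> Poly_Mapping.keys p \<longrightarrow> preceq prec \<beta> \<alpha>))"

text \<open>The convention for the leading exponent of \<open>0\<close>: it is the value \<open>None\<close>, which lies
  below all exponents and is absorbing for addition.\<close>

definition le0 ::
  "('n expo \<Rightarrow> 'n expo \<Rightarrow> bool) \<Rightarrow> ('n::{finite,linorder}, 'k::field) free_alg \<Rightarrow> 'n expo option"
  where "le0 prec p = (if p = 0 then None else Some (lexp prec p))"

fun expo_plus :: "'n expo option \<Rightarrow> 'n expo option \<Rightarrow> 'n expo option"
  where
    "expo_plus (Some \<alpha>) (Some \<beta>) = Some (\<alpha> + \<beta>)"
  | "expo_plus _ _ = None"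

fun expo_preceq :: "('n expo \<Rightarrow> 'n expo \<Rightarrow> bool) \<Rightarrow> 'n expo option \<Rightarrow> 'n expo option \<Rightarrow> bool"
  where
    "expo_preceq prec None _ = True"
  | "expo_preceq prec (Some \<alpha>) None = False"
  | "expo_preceq prec (Some \<alpha>) (Some \<beta>) = preceq prec \<alpha> \<beta>"

definition lexps ::
  "('n expo \<Rightarrow> 'n expo \<Rightarrow> bool) \<Rightarrow> ('n::{finite,linorder}, 'k::field) free_alg set \<Rightarrow> 'n expo set"
  where "lexps prec G = {lexp prec g | g. g \<in> G \<and> g \<noteq> 0}"

definition Lexps ::
  "('n expo \<Rightarrow> 'n expo \<Rightarrow> bool) \<Rightarrow> ('n::{finite,linorder}, 'k::field) free_alg set \<Rightarrow> 'n expo set"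
  where "Lexps prec G = {\<alpha> + \<gamma> | \<alpha> \<gamma>. \<alpha> \<in> lexps prec G}"


section \<open>Commutation systems\<close>

text \<open>One reduction replaces the single word \<open>m x\<^sub>j x\<^sub>i m'\<close> (with \<open>i < j\<close>) by
  \<open>m (c i j x\<^sub>i x\<^sub>j + d i j) m'\<close>; extended linearly, only the term of \<open>p\<close> at that word changes.\<close>

definition reduction ::
  "('n \<Rightarrow> 'n \<Rightarrow> 'k) \<Rightarrow> ('n \<Rightarrow> 'n \<Rightarrow> ('n, 'k) free_alg) \<Rightarrow>
    ('n::{finite,linorder}, 'k::field) free_alg \<Rightarrow> ('n, 'k) free_alg \<Rightarrow> bool"
  where "reduction c d p q \<longleftrightarrow> (\<exists>m m' i j. i < j \<and>
    (let w = m + Word [j, i] + m'; a = Poly_Mapping.lookup p w in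
      q = p - scalar a * mon w
            + scalar a * (mon m * (scalar (c i j) * var i * var j + d i j) * mon m')))"

definition commutation_system ::
  "('n::{finite,linorder}, 'k::field) free_alg set \<Rightarrow> ('n expo \<Rightarrow> 'n expo \<Rightarrow> bool) \<Rightarrow> bool"
  where "commutation_system S prec \<longleftrightarrow> monomial_ordering prec \<and>
    (\<exists>c d.
      S = {var j * var i - scalar (c i j) * var i * var j - d i j | i j. i < j} \<and>
      (\<forall>i j. i < j \<longrightarrow> c i j \<noteq> 0 \<and> d i j \<in> std_polys \<and>
        (d i j = 0 \<or>
         prec (lexp prec (d i j)) (Poly_Mapping.single i 1 + Poly_Mapping.single j 1))) \<and>
      (\<forall>p. \<exists>q \<in> std_polys. (reduction c d)\<^sup>*\<^sup>* p q))"


section \<open>PBW-reduction-algebras\<close>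

definition relations_ideal ::
  "('n, 'k::field) free_alg set \<Rightarrow> ('n, 'k) free_alg set \<Rightarrow> ('n, 'k) free_alg set"
  where "relations_ideal S I = Idl\<^bsub>free_ring\<^esub> (I \<union> S)"

definition pbw_datum ::
  "('n::{finite,linorder}, 'k::field) free_alg set \<Rightarrow> ('n, 'k) free_alg set \<Rightarrow>
    ('n expo \<Rightarrow> 'n expo \<Rightarrow> bool) \<Rightarrow> bool"
  where "pbw_datum S I prec \<longleftrightarrow>
    commutation_system S prec \<and> well_ordering prec \<and>
    finite I \<and> I \<subseteq> std_polys \<and>
    Lexps prec I = lexps prec (relations_ideal S I \<inter> std_polys)"

definition pbw_algebra ::
  "('n, 'k::field) free_alg set \<Rightarrow> ('n, 'k) free_alg set \<Rightarrow> ('n, 'k) free_alg set ring"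
  where "pbw_algebra S I = free_ring Quot relations_ideal S I"

text \<open>Elements of \<open>pbw_algebra S I\<close> are cosets, so that representing an element means belonging
  to it.  In particular \<open>nf\<close> and \<open>le_alg\<close> do not take \<open>S\<close> as an argument.\<close>

definition nf ::
  "('n::{finite,linorder}, 'k::field) free_alg set \<Rightarrow> ('n expo \<Rightarrow> 'n expo \<Rightarrow> bool) \<Rightarrow>
    ('n, 'k) free_alg set \<Rightarrow> ('n, 'k) free_alg"
  where "nf I prec a =
    (THE p. p \<in> a \<and> Poly_Mapping.keys p \<subseteq> {std_word \<alpha> | \<alpha>. \<alpha> \<notin> Lexps prec I})"

definition le_alg ::
  "('n::{finite,linorder}, 'k::field) free_alg set \<Rightarrow> ('n expo \<Rightarrow> 'n expo \<Rightarrow> bool) \<Rightarrow>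
    ('n, 'k) free_alg set \<Rightarrow> 'n expo option"
  where "le_alg I prec a = le0 prec (nf I prec a)"

definition left_ideal :: "'a set \<Rightarrow> ('a, 'b) ring_scheme \<Rightarrow> bool"
  where "left_ideal M R \<longleftrightarrow>
    additive_subgroup M R \<and> (\<forall>a \<in> carrier R. \<forall>m \<in> M. a \<otimes>\<^bsub>R\<^esub> m \<in> M)"

definition left_groebner_basis ::
  "('n::{finite,linorder}, 'k::field) free_alg set \<Rightarrow> ('n, 'k) free_alg set \<Rightarrow>
    ('n expo \<Rightarrow> 'n expo \<Rightarrow> bool) \<Rightarrow>
    ('n, 'k) free_alg set set \<Rightarrow> ('n, 'k) free_alg set set \<Rightarrow> bool"
  where "left_groebner_basis S I prec G M \<longleftrightarrow>
    left_ideal M (pbw_algebra S I) \<and> finite G \<and> G \<subseteq> M \<and>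
    (\<forall>m \<in> M. \<exists>a. a \<in> G \<rightarrow> carrier (pbw_algebra S I) \<and>
      m = (\<Oplus>\<^bsub>pbw_algebra S I\<^esub>g \<in> G. a g \<otimes>\<^bsub>pbw_algebra S I\<^esub> g) \<and>
      (\<forall>g \<in> G. expo_preceq prec
        (expo_plus (le_alg I prec (a g)) (le_alg I prec g)) (le_alg I prec m)))"

end

theory Submission
  imports Defs
begin

text \<open>Let \<open>J\<close> be the ideal of relations of \<open>A\<close>, and let \<open>J'\<close> be the preimage of \<open>M\<close> in the free
  algebra.  As \<open>G\<close> generates \<open>M\<close> even as a left ideal, \<open>J'\<close> is generated by \<open>S\<close>, \<open>I\<close> and the
  normal forms of \<open>G\<close> (lemma \<open>preimage_eq_relations_ideal\<close>), and the isomorphism is the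
  isomorphism theorem for the composite of the two projections.  What has to be proved is
  that the leading exponents of \<open>J'\<close> on standard polynomials are exactly the exponents divisible by
  the leading exponent of an element of \<open>I\<close> or of the normal form of an element of \<open>G\<close>.  Below,
  \<open>L(I)\<close> stands for \<open>Lexps prec I\<close>.

  The means for comparing products in the free algebra with standard polynomials is the
  multidegree of a word, which forgets the order of the letters.  A reduction replaces a word by a
  nonzero multiple of a word of the same multidegree plus words of smaller multidegree.  Hence
  rewriting into a standard polynomial never raises multidegrees, and it preserves a leading term
  that is carried by a single word (lemma \<open>straighten\<close>).

  One inclusion follows by straightening \<open>x\<^sup>\<gamma> f\<close>: its top multidegree is carried by a single word, so
  the leading exponent of the result is the sum of \<open>\<gamma>\<close> and the leading exponent of \<open>f\<close> (lemma
  \<open>Lexps_subset_lexps\<close>).  For the other inclusion, let \<open>f\<close> be a standard polynomial in \<open>J'\<close> whose leading exponent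
  \<open>\<alpha>\<close> is not in \<open>L(I)\<close>.  Then \<open>\<alpha>\<close> is also the leading exponent of the class of \<open>f\<close>, and the Groebner
  basis property writes this class as a sum of products \<open>a\<^sub>g g\<close> with leading exponents adding up to
  at most \<open>\<alpha>\<close>.  If every one of these sums were smaller than \<open>\<alpha>\<close>, straightening the sum of the products of
  normal forms would give a standard polynomial \<open>t\<close> congruent to \<open>f\<close> modulo \<open>J\<close> with all exponents
  below \<open>\<alpha>\<close>; but then \<open>f - t\<close> lies in \<open>J\<close> and has leading exponent \<open>\<alpha>\<close>, which would
  place \<open>\<alpha>\<close> in \<open>L(I)\<close>.  So \<open>\<alpha>\<close> is divisible by the leading exponent of some \<open>g\<close> (lemma
  \<open>leading_exponents_of_preimage\<close>).

  Everything rests on the existence of normal forms.  They are found by induction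
  along the ordering, which is well-founded by Dickson's lemma.\<close>

section \<open>Multidegrees of words\<close>

definition mdeg :: "'n word \<Rightarrow> 'n expo"
  where "mdeg w = (\<Sum>i\<leftarrow>letters w. Poly_Mapping.single i 1)"

lemma mdeg_add: "mdeg (v + w) = mdeg v + mdeg w"
  by (simp add: mdeg_def plus_word_def)

lemma mdeg_zero [simp]: "mdeg 0 = 0"
  by (simp add: mdeg_def zero_word_def)

lemma mdeg_Word_two: "mdeg (Word [i, j]) = Poly_Mapping.single i 1 + Poly_Mapping.single j 1"
  by (simp add: mdeg_def)

lemma lookup_mdeg: "Poly_Mapping.lookup (mdeg w) i = count_list (letters w) i"
proof -
  have "Poly_Mapping.lookup (\<Sum>i\<leftarrow>xs. Poly_Mapping.single i (1::nat)) i = count_list xs i" for xs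
    by (induction xs) (auto simp: lookup_add lookup_single)
  then show ?thesis
    by (simp add: mdeg_def)
qed

lemma mdeg_std_word [simp]: "mdeg (std_word \<alpha>) = \<alpha>"
proof (rule poly_mapping_eqI)
  fix i :: 'a
  have rep: "count_list (replicate n j) i = (if j = i then n else 0)" for n and j :: 'a
    by (induction n) auto
  have conc: "count_list (concat (map (\<lambda>j. replicate (Poly_Mapping.lookup \<alpha> j) j) xs)) i
      = (if i \<in> set xs then Poly_Mapping.lookup \<alpha> i else 0)" if "distinct xs" for xs
    using that by (induction xs) (auto simp: rep)
  show "Poly_Mapping.lookup (mdeg (std_word \<alpha>)) i = Poly_Mapping.lookup \<alpha> i"
    by (simp add: lookup_mdeg std_word_def conc)
qed

lemma std_word_inj [simp]: "std_word \<alpha> = std_word \<beta> \<longleftrightarrow> \<alpha> = \<beta>"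
  by (metis mdeg_std_word)

text \<open>Bounds on degrees are expressed by arbitrary sets of exponents, so that one closure lemma serves
  strict bounds, weak bounds and the complement of the set of leading exponents alike.\<close>

definition degrees_in :: "'n expo set \<Rightarrow> ('n, 'k::field) free_alg set"
  where "degrees_in D = {p. mdeg ` Poly_Mapping.keys p \<subseteq> D}"

lemma degrees_inI:
  "(\<And>w. Poly_Mapping.lookup p w \<noteq> 0 \<Longrightarrow> mdeg w \<in> D) \<Longrightarrow> p \<in> degrees_in D"
  by (auto simp: degrees_in_def in_keys_iff)

lemma degrees_inD:
  "p \<in> degrees_in D \<Longrightarrow> Poly_Mapping.lookup p w \<noteq> 0 \<Longrightarrow> mdeg w \<in> D"
  by (auto simp: degrees_in_def in_keys_iff)

lemma degrees_in_mono: "p \<in> degrees_in D \<Longrightarrow> D \<subseteq> E \<Longrightarrow> p \<in> degrees_in E"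
  by (auto simp: degrees_in_def)

lemma degrees_in_zero [simp]: "0 \<in> degrees_in D"
  by (simp add: degrees_in_def)

lemma degrees_in_single: "c = 0 \<or> mdeg w \<in> D \<Longrightarrow> Poly_Mapping.single w c \<in> degrees_in D"
  by (auto simp: degrees_in_def)

lemma degrees_in_add:
  assumes "p \<in> degrees_in D" and "q \<in> degrees_in D"
  shows "p + q \<in> degrees_in D"
  using assms keys_add[of p q] unfolding degrees_in_def by blast

lemma degrees_in_diff:
  assumes "p \<in> degrees_in D" and "q \<in> degrees_in D"
  shows "p - q \<in> degrees_in D"
proof (rule degrees_inI)
  fix w
  assume "Poly_Mapping.lookup (p - q) w \<noteq> 0"
  then have "Poly_Mapping.lookup p w \<noteq> 0 \<or> Poly_Mapping.lookup q w \<noteq> 0"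
    by (auto simp: lookup_minus)
  with assms show "mdeg w \<in> D"
    using degrees_inD by blast
qed

lemma degrees_in_sum: "(\<And>x. x \<in> Y \<Longrightarrow> f x \<in> degrees_in D) \<Longrightarrow> sum f Y \<in> degrees_in D"
  by (induction Y rule: infinite_finite_induct) (auto intro: degrees_in_add)

lemma degrees_in_mult:
  assumes "p \<in> degrees_in C" and "q \<in> degrees_in D"
    and "\<And>\<gamma> \<delta>. \<gamma> \<in> C \<Longrightarrow> \<delta> \<in> D \<Longrightarrow> \<gamma> + \<delta> \<in> E"
  shows "p * q \<in> degrees_in E"
proof (rule degrees_inI)
  fix w
  assume "Poly_Mapping.lookup (p * q) w \<noteq> 0"
  then obtain u v where "w = u + v" "u \<in> Poly_Mapping.keys p" "v \<in> Poly_Mapping.keys q"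
    using keys_mult[of p q] by (auto simp: in_keys_iff)
  with assms show "mdeg w \<in> E"
    by (auto simp: mdeg_add degrees_in_def)
qed

section \<open>The space of standard polynomials\<close>

lemma std_polysI:
  "(\<And>w. Poly_Mapping.lookup p w \<noteq> 0 \<Longrightarrow> w \<in> range std_word) \<Longrightarrow> p \<in> std_polys"
  by (auto simp: std_polys_def in_keys_iff)

lemma std_polysD: "p \<in> std_polys \<Longrightarrow> Poly_Mapping.lookup p w \<noteq> 0 \<Longrightarrow> w = std_word (mdeg w)"
  unfolding std_polys_def by (metis (mono_tags) in_keys_iff mdeg_std_word mem_Collect_eq rangeE subsetD)

lemma std_polys_add: "p \<in> std_polys \<Longrightarrow> q \<in> std_polys \<Longrightarrow> p + q \<in> std_polys"
  using keys_add[of p q] by (auto simp: std_polys_def)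

lemma std_polys_diff:
  assumes "p \<in> std_polys" and "q \<in> std_polys"
  shows "p - q \<in> std_polys"
proof (rule std_polysI)
  fix w
  assume "Poly_Mapping.lookup (p - q) w \<noteq> 0"
  then have "w \<in> Poly_Mapping.keys p \<or> w \<in> Poly_Mapping.keys q"
    by (auto simp: lookup_minus in_keys_iff)
  with assms show "w \<in> range std_word"
    by (auto simp: std_polys_def)
qed

lemma std_polys_zero: "0 \<in> std_polys"
  by (simp add: std_polys_def)

lemma lookup_scalar_mult: "Poly_Mapping.lookup (scalar a * p) w = a * Poly_Mapping.lookup p w"
proof -
  have "Poly_Mapping.lookup (scalar a * p) w
      = (\<Sum>l. (a * (\<Sum>q. Poly_Mapping.lookup p q when w = l + q)) when l = 0)"
    unfolding lookup_mult scalar_def lookup_single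
    by (rule arg_cong[where f = Sum_any]) (auto simp: fun_eq_iff when_def)
  then show ?thesis
    by simp
qed

lemma std_polys_scalar_mult: "p \<in> std_polys \<Longrightarrow> scalar a * p \<in> std_polys"
  by (auto simp: std_polys_def in_keys_iff lookup_scalar_mult subset_eq)

section \<open>Well-foundedness of monomial well-orderings\<close>

text \<open>Every sequence has a monotone subsequence; a weakly decreasing one of natural numbers is constant
  from some point on.\<close>

lemma incseq_subseq_nat:
  fixes s :: "nat \<Rightarrow> nat"
  obtains r where "strict_mono r" and "incseq (\<lambda>n. s (r n))"
proof -
  obtain f where f: "strict_mono f" "monoseq (\<lambda>n. s (f n))"
    using seq_monosub by blast
  show thesis
  proof (cases "incseq (\<lambda>n. s (f n))")
    case True
    then show ?thesis using that f by blast
  next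
    case False
    then have dec: "s (f n) \<le> s (f m)" if "m \<le> n" for m n
      using f(2) that by (auto simp: monoseq_def incseq_def)
    obtain N where N: "\<And>n. s (f N) \<le> s (f n)"
      using ex_has_least_nat[of "\<lambda>_. True" 0 "\<lambda>n. s (f n)"] by auto
    have "s (f (N + n)) = s (f N)" for n
      by (intro antisym dec N) simp
    moreover have "strict_mono (\<lambda>n. f (N + n))"
      using f(1) by (simp add: strict_mono_def)
    ultimately show ?thesis
      using that[of "\<lambda>n. f (N + n)"] by (simp add: incseq_def)
  qed
qed

text \<open>Passing to a subsequence preserves monotonicity of the coordinates already treated, so the
  coordinates can be handled one after the other.\<close>

lemma dickson_subseq:
  fixes f :: "nat \<Rightarrow> 'n expo"
  assumes "finite A"
  shows "\<exists>r. strict_mono r \<and> (\<forall>i\<in>A. incseq (\<lambda>n. Poly_Mapping.lookup (f (r n)) i))"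
  using assms
proof (induction A)
  case empty
  show ?case
    by (auto intro: strict_mono_id[unfolded id_def] simp: strict_mono_def)
next
  case (insert x A)
  then obtain r where r: "strict_mono r" "\<forall>i\<in>A. incseq (\<lambda>n. Poly_Mapping.lookup (f (r n)) i)"
    by blast
  obtain t where t: "strict_mono t" "incseq (\<lambda>n. Poly_Mapping.lookup (f (r (t n))) x)"
    by (rule incseq_subseq_nat)
  have "incseq (\<lambda>n. Poly_Mapping.lookup (f (r (t n))) i)" if "i \<in> A" for i
    using r(2) that strict_mono_mono[OF t(1)] by (auto simp: incseq_def mono_def)
  with t r(1) show ?case
    by (intro exI[of _ "r \<circ> t"]) (auto simp: strict_mono_def)
qed

text \<open>Dickson's lemma; adding exponents is multiplying monomials, so the equation says that one monomial
  divides the other.\<close>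

lemma dickson:
  fixes f :: "nat \<Rightarrow> ('n::finite) expo"
  obtains i j \<gamma> where "i < j" and "f j = f i + \<gamma>"
proof -
  obtain r where r: "strict_mono r" "\<And>x. incseq (\<lambda>n. Poly_Mapping.lookup (f (r n)) x)"
    using dickson_subseq[of "UNIV :: 'n set" f] by auto
  have "f (r 1) = f (r 0) + (f (r 1) - f (r 0))"
    by (rule poly_mapping_eqI) (use r(2) in \<open>simp add: lookup_add lookup_minus incseq_def\<close>)
  with that[of "r 0" "r 1"] r(1) show thesis
    by (simp add: strict_mono_def)
qed

locale monomial_order =
  fixes prec :: "'n::{finite,linorder} expo \<Rightarrow> 'n expo \<Rightarrow> bool" (infix \<open>\<prec>\<close> 50)
  assumes monomial_ordering: "monomial_ordering prec"
begin

abbreviation below :: "'n expo \<Rightarrow> 'n expo set"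
  where "below \<delta> \<equiv> {\<beta>. \<beta> \<prec> \<delta>}"

lemma order_props: "irreflp prec" "transp prec" "totalp prec"
  and add_right: "\<alpha> \<prec> \<beta> \<Longrightarrow> \<alpha> + \<gamma> \<prec> \<beta> + \<gamma>"
  using monomial_ordering unfolding monomial_ordering_def by blast+

lemma irrefl [simp]: "\<not> \<alpha> \<prec> \<alpha>"
  using order_props(1) by (rule irreflpD)

lemma prec_trans [trans]: "\<alpha> \<prec> \<beta> \<Longrightarrow> \<beta> \<prec> \<gamma> \<Longrightarrow> \<alpha> \<prec> \<gamma>"
  using order_props(2) by (rule transpD)

lemma total: "\<alpha> \<prec> \<beta> \<or> \<alpha> = \<beta> \<or> \<beta> \<prec> \<alpha>"
  using order_props(3) totalpD by metis

lemma add_left: "\<alpha> \<prec> \<beta> \<Longrightarrow> \<gamma> + \<alpha> \<prec> \<gamma> + \<beta>"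
  using add_right[of \<alpha> \<beta> \<gamma>] by (simp add: add.commute)

lemma preceq_trans: "preceq prec \<alpha> \<beta> \<Longrightarrow> preceq prec \<beta> \<gamma> \<Longrightarrow> preceq prec \<alpha> \<gamma>"
  unfolding preceq_def using prec_trans by blast

lemma preceq_prec_trans: "preceq prec \<alpha> \<beta> \<Longrightarrow> \<beta> \<prec> \<gamma> \<Longrightarrow> \<alpha> \<prec> \<gamma>"
  unfolding preceq_def using prec_trans by blast

lemma preceq_add:
  assumes "preceq prec \<alpha> \<beta>" and "preceq prec \<gamma> \<delta>"
  shows "preceq prec (\<alpha> + \<gamma>) (\<beta> + \<delta>)"
proof (rule preceq_trans)
  show "preceq prec (\<alpha> + \<gamma>) (\<beta> + \<gamma>)"
    using assms(1) add_right by (auto simp: preceq_def)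
  show "preceq prec (\<beta> + \<gamma>) (\<beta> + \<delta>)"
    using assms(2) add_left by (auto simp: preceq_def)
qed

text \<open>In a descending sequence, Dickson's lemma finds a member dividing a later one; as \<open>0\<close>
  is the least exponent, the later one cannot be smaller.\<close>

lemma wfp_prec:
  assumes "well_ordering prec"
  shows "wfp prec"
proof -
  have False if desc: "\<And>i. f (Suc i) \<prec> f i" for f
  proof -
    have chain: "f j \<prec> f i" if "i < j" for i j
      using that
    proof (induction j)
      case (Suc j)
      then show ?case
        using desc[of j] prec_trans by (auto simp: less_Suc_eq)
    qed simp
    obtain i j \<gamma> where "i < j" "f j = f i + \<gamma>"
      by (rule dickson)
    moreover have "preceq prec (f i + 0) (f i + \<gamma>)"
      using assms by (intro preceq_add) (auto simp: well_ordering_def preceq_def)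
    ultimately show False
      using chain[of i j] prec_trans[of "f i" "f j" "f i"] by (auto simp: preceq_def)
  qed
  then have "wf {(x, y). x \<prec> y}"
    by (auto simp: wf_iff_no_infinite_down_chain)
  then show ?thesis
    by (simp add: wfp_def)
qed

section \<open>Leading terms\<close>

text \<open>A substitute for leading monomials that makes sense for elements that are not standard
  polynomials, such as the intermediate results of a rewriting process: several words may share a multidegree,
  but the largest one has to be carried by one word only.\<close>

definition has_lead :: "'n expo \<Rightarrow> ('n, 'k::field) free_alg \<Rightarrow> bool"
  where "has_lead \<delta> p \<longleftrightarrow> (\<exists>w c r. p = Poly_Mapping.single w c + r \<and> c \<noteq> 0 \<and> mdeg w = \<delta> \<and>
    r \<in> degrees_in (below \<delta>))"

lemma has_leadI:
  "p = Poly_Mapping.single w c + r \<Longrightarrow> c \<noteq> 0 \<Longrightarrow> mdeg w = \<delta> \<Longrightarrow> r \<in> degrees_in (below \<delta>) \<Longrightarrow>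
    has_lead \<delta> p"
  unfolding has_lead_def by blast

lemma has_leadE:
  assumes "has_lead \<delta> p"
  obtains w c r where "p = Poly_Mapping.single w c + r" and "c \<noteq> 0" and "mdeg w = \<delta>"
    and "r \<in> degrees_in (below \<delta>)"
  using assms unfolding has_lead_def by blast

lemma has_lead_add:
  assumes "has_lead \<delta> p" and "q \<in> degrees_in (below \<delta>)"
  shows "has_lead \<delta> (p + q)"
  using assms(1)
proof (rule has_leadE)
  fix w c r
  assume "p = Poly_Mapping.single w c + r" "c \<noteq> 0" "mdeg w = \<delta>" "r \<in> degrees_in (below \<delta>)"
  then show ?thesis
    using assms(2) by (intro has_leadI[of _ w c "r + q"]) (auto simp: add.assoc intro: degrees_in_add)
qed

lemma has_lead_diff: "has_lead \<delta> p \<Longrightarrow> q \<in> degrees_in (below \<delta>) \<Longrightarrow> has_lead \<delta> (p - q)"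
  using has_lead_add[of \<delta> p "0 - q"] degrees_in_diff[of 0 _ q] by simp

lemma lookup_degree_notin: "p \<in> degrees_in D \<Longrightarrow> mdeg w \<notin> D \<Longrightarrow> Poly_Mapping.lookup p w = 0"
  using degrees_inD by blast

text \<open>Multiplication by a word translates all multidegrees by the same amount, and the ordering is
  invariant under translation.\<close>

lemma has_lead_mult_left:
  assumes "has_lead \<delta> p"
  shows "has_lead (mdeg v + \<delta>) (mon v * p)"
proof -
  obtain w c r where p: "p = Poly_Mapping.single w c + r" "c \<noteq> 0" "mdeg w = \<delta>"
      "r \<in> degrees_in (below \<delta>)"
    using assms by (auto elim: has_leadE)
  have "mon v * p = Poly_Mapping.single (v + w) c + mon v * r"
    by (simp add: p(1) mon_def distrib_left mult_single)
  moreover have "mon v * r \<in> degrees_in (below (mdeg v + \<delta>))"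
    by (rule degrees_in_mult[of _ "{mdeg v}" _ "below \<delta>"])
      (use p(4) in \<open>auto simp: mon_def intro: degrees_in_single add_left\<close>)
  ultimately show ?thesis
    using p by (intro has_leadI[of _ "v + w" c]) (auto simp: mdeg_add)
qed

lemma lexp_unique:
  assumes "Poly_Mapping.lookup p (std_word \<alpha>) \<noteq> 0"
    and "\<And>w. Poly_Mapping.lookup p w \<noteq> 0 \<Longrightarrow> w = std_word \<alpha> \<or> mdeg w \<prec> \<alpha>"
  shows "lexp prec p = \<alpha>"
  unfolding lexp_def
proof (rule the_equality)
  show "std_word \<alpha> \<in> Poly_Mapping.keys p \<and>
      (\<forall>\<beta>. std_word \<beta> \<in> Poly_Mapping.keys p \<longrightarrow> preceq prec \<beta> \<alpha>)"
    using assms by (fastforce simp: in_keys_iff preceq_def)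
next
  fix \<beta>
  assume "std_word \<beta> \<in> Poly_Mapping.keys p \<and>
      (\<forall>\<gamma>. std_word \<gamma> \<in> Poly_Mapping.keys p \<longrightarrow> preceq prec \<gamma> \<beta>)"
  then have "preceq prec \<alpha> \<beta>" and "\<beta> = \<alpha> \<or> \<beta> \<prec> \<alpha>"
    using assms(1) assms(2)[of "std_word \<beta>"] by (auto simp: in_keys_iff)
  then show "\<beta> = \<alpha>"
    using prec_trans[of \<alpha> \<beta> \<alpha>] by (auto simp: preceq_def)
qed

lemma has_lead_lexp_eq:
  assumes "p \<in> std_polys" and "has_lead \<delta> p"
  shows "lexp prec p = \<delta>" and "p \<noteq> 0"
proof -
  obtain w c r where p: "p = Poly_Mapping.single w c + r" "c \<noteq> 0" "mdeg w = \<delta>"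
      "r \<in> degrees_in (below \<delta>)"
    using assms by (auto elim: has_leadE)
  have "Poly_Mapping.lookup r w = 0"
    using p by (intro lookup_degree_notin) auto
  then have lw: "Poly_Mapping.lookup p w = c"
    by (simp add: p(1) lookup_add)
  with p(2) show "p \<noteq> 0" by auto
  have w: "w = std_word \<delta>"
    using std_polysD[OF assms(1), of w] lw p by simp
  show "lexp prec p = \<delta>"
  proof (rule lexp_unique)
    show "v = std_word \<delta> \<or> mdeg v \<prec> \<delta>" if "Poly_Mapping.lookup p v \<noteq> 0" for v
      using that degrees_inD[OF p(4), of v] w
      by (auto simp: p(1) lookup_add lookup_single when_def split: if_splits)
  qed (use lw p w in auto)
qed

text \<open>Distinct standard words have distinct multidegrees, so the largest multidegree is attained by a
  single word.\<close>

lemma has_lead_lexp: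
  assumes "p \<in> std_polys" and "p \<noteq> 0"
  shows "has_lead (lexp prec p) p"
proof -
  let ?E = "mdeg ` Poly_Mapping.keys p"
  have "Poly_Mapping.keys p \<noteq> {}"
    using assms(2) by (metis lookup_zero in_keys_iff poly_mapping_eqI empty_iff)
  then have "\<exists>\<alpha>\<in>?E. \<forall>\<beta>\<in>?E. \<beta> \<noteq> \<alpha> \<longrightarrow> \<beta> \<prec> \<alpha>"
    using order_props(2,3)
    by (intro Finite_Set.bex_greatest_element) (auto intro: transp_on_subset totalp_on_subset)
  then obtain w where w: "Poly_Mapping.lookup p w \<noteq> 0"
      "\<And>v. Poly_Mapping.lookup p v \<noteq> 0 \<Longrightarrow> mdeg v \<noteq> mdeg w \<Longrightarrow> mdeg v \<prec> mdeg w"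
    by (auto simp: in_keys_iff)
  have uniq: "v = w" if "Poly_Mapping.lookup p v \<noteq> 0" "mdeg v = mdeg w" for v
    using that w(1) std_polysD[OF assms(1)] by metis
  define r where "r = p - Poly_Mapping.single w (Poly_Mapping.lookup p w)"
  have "r \<in> degrees_in (below (mdeg w))"
  proof (rule degrees_inI)
    fix v assume "Poly_Mapping.lookup r v \<noteq> 0"
    then have "Poly_Mapping.lookup p v \<noteq> 0" "v \<noteq> w"
      by (auto simp: r_def lookup_minus lookup_single when_def split: if_splits)
    then show "mdeg v \<in> below (mdeg w)"
      using w(2) uniq by blast
  qed
  then have "has_lead (mdeg w) p"
    using w(1) by (intro has_leadI[of _ w "Poly_Mapping.lookup p w" r]) (simp_all add: r_def)
  then show ?thesis
    using has_lead_lexp_eq(1)[OF assms(1)] by metis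
qed

lemma has_lead_degree_mem:
  assumes "has_lead \<delta> p" and "p \<in> degrees_in D"
  shows "\<delta> \<in> D"
proof -
  obtain w c r where p: "p = Poly_Mapping.single w c + r" "c \<noteq> 0" "mdeg w = \<delta>"
      "r \<in> degrees_in (below \<delta>)"
    using assms(1) by (rule has_leadE)
  have "Poly_Mapping.lookup r w = 0"
    using p by (intro lookup_degree_notin) auto
  then have "Poly_Mapping.lookup p w \<noteq> 0"
    using p by (simp add: lookup_add)
  then show ?thesis
    using degrees_inD[OF assms(2)] p(3) by blast
qed

lemma has_lead_degrees_in:
  assumes "has_lead \<delta> p"
  shows "p \<in> degrees_in {\<beta>. preceq prec \<beta> \<delta>}"
proof -
  obtain w c r where p: "p = Poly_Mapping.single w c + r" "mdeg w = \<delta>"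
      "r \<in> degrees_in (below \<delta>)"
    using assms by (auto elim: has_leadE)
  have "r \<in> degrees_in {\<beta>. preceq prec \<beta> \<delta>}"
    by (rule degrees_in_mono[OF p(3)]) (auto simp: preceq_def)
  then show ?thesis
    unfolding p(1) using p(2) by (intro degrees_in_add degrees_in_single) (auto simp: preceq_def)
qed

lemma std_polys_below_degrees_in:
  assumes "p \<in> std_polys" and "p = 0 \<or> lexp prec p \<prec> \<delta>"
  shows "p \<in> degrees_in (below \<delta>)"
proof (cases "p = 0")
  case False
  then have "lexp prec p \<prec> \<delta>"
    using assms(2) by simp
  then show ?thesis
    using prec_trans
    by (intro degrees_in_mono[OF has_lead_degrees_in[OF has_lead_lexp[OF assms(1) False]]])
      (auto simp: preceq_def)
qed simp

text \<open>A standard polynomial has at most one word of each multidegree, so that subtracting a multiple of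
  \<open>h\<close> can remove everything of multidegree \<open>\<alpha>\<close>.\<close>

lemma cancel_lead:
  assumes std: "p \<in> std_polys" "h \<in> std_polys"
    and p: "p \<in> degrees_in {\<beta>. preceq prec \<beta> \<alpha>}" and h: "has_lead \<alpha> h"
  obtains a where "p - scalar a * h \<in> degrees_in (below \<alpha>)"
proof -
  obtain w b r where h: "h = Poly_Mapping.single w b + r" "b \<noteq> 0" "mdeg w = \<alpha>"
      "r \<in> degrees_in (below \<alpha>)"
    using h by (rule has_leadE)
  have "Poly_Mapping.lookup r w = 0"
    using h by (intro lookup_degree_notin) auto
  then have lw: "Poly_Mapping.lookup h w = b"
    by (simp add: h(1) lookup_add)
  have w: "w = std_word \<alpha>"
    using std_polysD[OF std(2), of w] lw h by simp
  define a where "a = Poly_Mapping.lookup p w / b"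
  have "p - scalar a * h \<in> degrees_in (below \<alpha>)"
  proof (rule degrees_inI)
    fix v
    assume v: "Poly_Mapping.lookup (p - scalar a * h) v \<noteq> 0"
    have "v \<noteq> w"
      using v lw h(2) by (auto simp: a_def lookup_minus lookup_scalar_mult)
    from v have "Poly_Mapping.lookup p v \<noteq> 0 \<or> Poly_Mapping.lookup r v \<noteq> 0"
      using \<open>v \<noteq> w\<close> by (auto simp: lookup_minus lookup_scalar_mult h(1) lookup_add lookup_single)
    then show "mdeg v \<in> below \<alpha>"
    proof
      assume pv: "Poly_Mapping.lookup p v \<noteq> 0"
      then have "mdeg v \<noteq> \<alpha>"
        using std_polysD[OF std(1) pv] w \<open>v \<noteq> w\<close> by auto
      then show ?thesis
        using degrees_inD[OF p pv] by (simp add: preceq_def)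
    qed (use degrees_inD[OF h(4)] in blast)
  qed
  then show thesis by (rule that)
qed

end


section \<open>Two-sided ideals and cosets in the free algebra\<close>

lemma free_ring_simps [simp]:
  "carrier free_ring = UNIV" "x \<otimes>\<^bsub>free_ring\<^esub> y = x * y" "x \<oplus>\<^bsub>free_ring\<^esub> y = x + y"
  "\<zero>\<^bsub>free_ring\<^esub> = 0" "\<one>\<^bsub>free_ring\<^esub> = 1"
  by (simp_all add: ring_of_type_algebra_def)

lemma free_ideal_zero: "ideal J free_ring \<Longrightarrow> 0 \<in> J"
  using additive_subgroup.zero_closed[OF ideal.axioms(1)] by fastforce

lemma free_ideal_add: "ideal J free_ring \<Longrightarrow> x \<in> J \<Longrightarrow> y \<in> J \<Longrightarrow> x + y \<in> J"
  using additive_subgroup.a_closed[OF ideal.axioms(1)] by fastforce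

lemma free_ideal_mult_left: "ideal J free_ring \<Longrightarrow> x \<in> J \<Longrightarrow> a * x \<in> J"
  using ideal.I_l_closed by fastforce

lemma free_ideal_mult_right: "ideal J free_ring \<Longrightarrow> x \<in> J \<Longrightarrow> x * a \<in> J"
  using ideal.I_r_closed by fastforce

lemma free_ideal_diff:
  assumes "ideal J free_ring" and "x \<in> J" and "y \<in> J"
  shows "x - y \<in> J"
  using free_ideal_add[OF assms(1,2) free_ideal_mult_left[OF assms(1,3), of "-1"]] by simp

lemma free_ideal_sum:
  "ideal J free_ring \<Longrightarrow> (\<And>x. x \<in> Y \<Longrightarrow> f x \<in> J) \<Longrightarrow> sum f Y \<in> J"
  by (induction Y rule: infinite_finite_induct) (simp_all add: free_ideal_zero free_ideal_add)

lemma free_ideal_minus_commute: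
  assumes "ideal J free_ring" and "x - y \<in> J"
  shows "y - x \<in> J"
  using free_ideal_diff[OF assms(1) free_ideal_zero[OF assms(1)] assms(2)] by simp

lemma free_ideal_diff_trans:
  assumes "ideal J free_ring" and "x - y \<in> J" and "y - z \<in> J"
  shows "x - z \<in> J"
  using free_ideal_add[OF assms] by simp

lemma mem_free_coset: 
  assumes "ideal J free_ring"
  shows "x \<in> J +>\<^bsub>free_ring\<^esub> p \<longleftrightarrow> x - p \<in> J"
proof
  assume "x \<in> J +>\<^bsub>free_ring\<^esub> p"
  then show "x - p \<in> J"
    by (auto simp: a_r_coset_def')
next
  assume "x - p \<in> J"
  then show "x \<in> J +>\<^bsub>free_ring\<^esub> p"
    by (auto simp: a_r_coset_def' intro!: bexI[of _ "x - p"])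
qed

lemma free_coset_eq_iff:
  assumes "ideal J free_ring"
  shows "J +>\<^bsub>free_ring\<^esub> p = J +>\<^bsub>free_ring\<^esub> q \<longleftrightarrow> p - q \<in> J"
proof
  assume "J +>\<^bsub>free_ring\<^esub> p = J +>\<^bsub>free_ring\<^esub> q"
  moreover have "p \<in> J +>\<^bsub>free_ring\<^esub> p"
    using free_ideal_zero[OF assms] by (simp add: mem_free_coset[OF assms])
  ultimately show "p - q \<in> J"
    by (simp add: mem_free_coset[OF assms])
next
  assume pq: "p - q \<in> J"
  show "J +>\<^bsub>free_ring\<^esub> p = J +>\<^bsub>free_ring\<^esub> q"
    using free_ideal_diff_trans[OF assms _ pq]
      free_ideal_diff_trans[OF assms _ free_ideal_minus_commute[OF assms pq]]
    by (auto simp: mem_free_coset[OF assms])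
qed

lemma ideal_relations_ideal: "ideal (relations_ideal S I) free_ring"
  unfolding relations_ideal_def by (rule ring.genideal_ideal[OF ring_free_ring]) simp

lemma relations_ideal_superset: "S \<subseteq> relations_ideal S I" "I \<subseteq> relations_ideal S I"
  using ring.genideal_self[OF ring_free_ring, of "I \<union> S"] by (auto simp: relations_ideal_def)

lemma relations_ideal_minimal:
  "ideal J free_ring \<Longrightarrow> S \<subseteq> J \<Longrightarrow> I \<subseteq> J \<Longrightarrow> relations_ideal S I \<subseteq> J"
  unfolding relations_ideal_def by (rule ring.genideal_minimal[OF ring_free_ring]) auto

section \<open>Straightening\<close>

lemma reduction_congruent:
  assumes J: "ideal J free_ring" and "reduction c d p q"
    and rel: "\<And>i j. i < j \<Longrightarrow> var j * var i - scalar (c i j) * var i * var j - d i j \<in> J"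
  shows "p - q \<in> J"
proof -
  obtain m m' i j a where ij: "i < j" and q: "q = p - scalar a * mon (m + Word [j, i] + m')
      + scalar a * (mon m * (scalar (c i j) * var i * var j + d i j) * mon m')"
    using assms(2) by (auto simp: reduction_def Let_def)
  let ?rel = "var j * var i - scalar (c i j) * var i * var j - d i j"
  have "mon (m + Word [j, i] + m') = mon m * (var j * var i) * (mon m' :: ('a, 'b) free_alg)"
    by (simp add: mon_def var_def mult_single plus_word_def)
  then have "p - q = scalar a * (mon m * ?rel * mon m')"
    by (simp add: q algebra_simps)
  moreover have "scalar a * (mon m * ?rel * mon m') \<in> J"
    by (intro free_ideal_mult_left[OF J] free_ideal_mult_right[OF J] rel ij)
  ultimately show ?thesis
    by simp
qed

context monomial_order
begin

text \<open>The effect of a reduction on multidegrees. The word \<open>w\<close> is traded for a nonzero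
  multiple of \<open>w'\<close>, which has two adjacent letters swapped, and a remainder \<open>r\<close> that
  comes from \<open>d i j\<close> and is smaller. A reduction at a word that does not occur changes nothing.\<close>

lemma reductionE:
  fixes d :: "'n \<Rightarrow> 'n \<Rightarrow> ('n, 'k::field) free_alg"
  assumes "reduction c d p q"
    and c: "\<And>i j. i < j \<Longrightarrow> c i j \<noteq> 0"
    and d: "\<And>i j. i < j \<Longrightarrow>
      d i j \<in> degrees_in (below (Poly_Mapping.single i 1 + Poly_Mapping.single j 1))"
  obtains w w' b r where
    "q = p - Poly_Mapping.single w (Poly_Mapping.lookup p w)
      + Poly_Mapping.single w' (Poly_Mapping.lookup p w * b) + r"
    and "b \<noteq> 0" and "w \<noteq> w'" and "mdeg w' = mdeg w"
    and "r \<in> degrees_in (below (mdeg w))" and "Poly_Mapping.lookup p w = 0 \<Longrightarrow> r = 0"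
proof -
  obtain m m' i j where ij: "i < j"
    and q: "q = p - scalar (Poly_Mapping.lookup p (m + Word [j, i] + m')) * mon (m + Word [j, i] + m')
      + scalar (Poly_Mapping.lookup p (m + Word [j, i] + m'))
        * (mon m * (scalar (c i j) * var i * var j + d i j) * mon m')"
    using assms(1) by (auto simp: reduction_def Let_def)
  define w where "w = m + Word [j, i] + m'"
  define w' where "w' = m + Word [i, j] + m'"
  define a where "a = Poly_Mapping.lookup p w"
  define r where "r = scalar a * (mon m * d i j * mon m')"
  have "scalar a * mon w = Poly_Mapping.single w a"
    by (simp add: scalar_def mon_def mult_single)
  moreover have "scalar a * (mon m * (scalar (c i j) * var i * var j) * mon m')
      = Poly_Mapping.single w' (a * c i j)"
    by (simp add: scalar_def mon_def var_def mult_single w'_def plus_word_def zero_word_def)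
  ultimately have "q = p - Poly_Mapping.single w a + Poly_Mapping.single w' (a * c i j) + r"
    unfolding q r_def a_def[symmetric] w_def[symmetric] distrib_left distrib_right
    by (simp add: add.assoc)
  moreover have "w \<noteq> w'"
    using ij by (simp add: w_def w'_def plus_word_def)
  moreover have "mdeg w' = mdeg w"
    by (simp add: w_def w'_def mdeg_add mdeg_Word_two ac_simps)
  moreover have "r \<in> degrees_in (below (mdeg w))"
    unfolding r_def
  proof (intro degrees_in_mult[of "scalar a" "{0}" _ "below (mdeg w)"]
      degrees_in_mult[of "mon m * d i j" _ "mon m'" "{mdeg m'}"])
    show "scalar a \<in> degrees_in {0}"
      by (simp add: scalar_def degrees_in_single)
    show "mon m' \<in> degrees_in {mdeg m'}"
      by (simp add: mon_def degrees_in_single)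
    show "mon m * d i j \<in> degrees_in (below (mdeg m + mdeg (Word [j, i])))"
      by (rule degrees_in_mult[of _ "{mdeg m}", OF _ d[OF ij]])
        (auto simp: mon_def degrees_in_single mdeg_Word_two add.commute[of "Poly_Mapping.single j _"]
          intro: add_left)
  qed (auto simp: w_def mdeg_add intro: add_right)
  moreover have "a = 0 \<Longrightarrow> r = 0"
    by (simp add: r_def scalar_def)
  ultimately show thesis
    using that c[OF ij] unfolding a_def by blast
qed

lemma reduction_degrees_in:
  fixes d :: "'n \<Rightarrow> 'n \<Rightarrow> ('n, 'k::field) free_alg"
  assumes "reduction c d p q"
    and c: "\<And>i j. i < j \<Longrightarrow> c i j \<noteq> 0"
    and d: "\<And>i j. i < j \<Longrightarrow>
      d i j \<in> degrees_in (below (Poly_Mapping.single i 1 + Poly_Mapping.single j 1))"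
    and D: "\<And>\<alpha> \<beta>. \<alpha> \<prec> \<beta> \<Longrightarrow> \<beta> \<in> D \<Longrightarrow> \<alpha> \<in> D"
    and p: "p \<in> degrees_in D"
  shows "q \<in> degrees_in D"
  using assms(1-3)
proof (rule reductionE)
  fix w w' b r
  assume q: "q = p - Poly_Mapping.single w (Poly_Mapping.lookup p w)
      + Poly_Mapping.single w' (Poly_Mapping.lookup p w * b) + r"
    and w': "mdeg w' = mdeg w" and r: "r \<in> degrees_in (below (mdeg w))"
      "Poly_Mapping.lookup p w = 0 \<Longrightarrow> r = 0"
  show ?thesis
  proof (cases "Poly_Mapping.lookup p w = 0")
    case True
    then show ?thesis using p r q by simp
  next
    case False
    then have "mdeg w \<in> D"
      using p degrees_inD by blast
    moreover from this have "r \<in> degrees_in D"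
      using D by (intro degrees_in_mono[OF r(1)]) blast
    ultimately show ?thesis
      unfolding q using p w' by (intro degrees_in_add degrees_in_diff degrees_in_single) auto
  qed
qed

text \<open>If the reduction hits the leading word, the swapped word takes its place, with a coefficient that
  is nonzero because \<open>c i j\<close> is. Otherwise only smaller words change.\<close>

lemma reduction_has_lead:
  fixes d :: "'n \<Rightarrow> 'n \<Rightarrow> ('n, 'k::field) free_alg"
  assumes "reduction c d p q"
    and c: "\<And>i j. i < j \<Longrightarrow> c i j \<noteq> 0"
    and d: "\<And>i j. i < j \<Longrightarrow>
      d i j \<in> degrees_in (below (Poly_Mapping.single i 1 + Poly_Mapping.single j 1))"
    and p: "has_lead \<delta> p"
  shows "has_lead \<delta> q"
  using assms(1-3)
proof (rule reductionE)
  fix w w' b r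
  assume q: "q = p - Poly_Mapping.single w (Poly_Mapping.lookup p w)
      + Poly_Mapping.single w' (Poly_Mapping.lookup p w * b) + r"
    and b: "b \<noteq> 0" and ww': "w \<noteq> w'" and w': "mdeg w' = mdeg w"
    and r: "r \<in> degrees_in (below (mdeg w))" "Poly_Mapping.lookup p w = 0 \<Longrightarrow> r = 0"
  obtain v a s where p: "p = Poly_Mapping.single v a + s" "a \<noteq> 0" "mdeg v = \<delta>"
      "s \<in> degrees_in (below \<delta>)"
    using p by (rule has_leadE)
  show ?thesis
  proof (cases "w = v")
    case True
    have "Poly_Mapping.lookup s v = 0"
      using p by (intro lookup_degree_notin) auto
    then have "Poly_Mapping.lookup p w = a"
      by (simp add: p(1) True lookup_add)
    then have "q = Poly_Mapping.single w' (a * b) + (s + r)"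
      by (simp add: q True p(1))
    then show ?thesis
      using p b w' r(1) True by (intro has_leadI[of q w' "a * b" "s + r"]) (auto intro: degrees_in_add)
  next
    case False
    then have lw: "Poly_Mapping.lookup p w = Poly_Mapping.lookup s w"
      by (simp add: p(1) lookup_add lookup_single)
    show ?thesis
    proof (cases "Poly_Mapping.lookup p w = 0")
      case True
      then show ?thesis using q r(2) assms(4) by simp
    next
      case False
      then have wd: "mdeg w \<in> below \<delta>"
        using lw degrees_inD[OF p(4)] by simp
      moreover from wd have "r \<in> degrees_in (below \<delta>)"
        using prec_trans by (intro degrees_in_mono[OF r(1)]) blast
      ultimately have "Poly_Mapping.single w' (Poly_Mapping.lookup p w * b) + r
          - Poly_Mapping.single w (Poly_Mapping.lookup p w) \<in> degrees_in (below \<delta>)"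
        using w' by (intro degrees_in_add degrees_in_diff degrees_in_single) auto
      from has_lead_add[OF assms(4) this] show ?thesis
        by (simp add: q algebra_simps)
    qed
  qed
qed

text \<open>Both invariants of a single reduction survive the rewriting into a standard polynomial.\<close>

lemma straighten:
  fixes p :: "('n, 'k::field) free_alg"
  assumes "commutation_system S prec" and J: "ideal J free_ring" and "S \<subseteq> J"
  obtains q where "q \<in> std_polys" and "p - q \<in> J"
    and "\<And>D. (\<And>\<alpha> \<beta>. \<alpha> \<prec> \<beta> \<Longrightarrow> \<beta> \<in> D \<Longrightarrow> \<alpha> \<in> D) \<Longrightarrow> p \<in> degrees_in D \<Longrightarrow> q \<in> degrees_in D"
    and "\<And>\<delta>. has_lead \<delta> p \<Longrightarrow> has_lead \<delta> q"
proof -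
  obtain c d where
      S: "S = {var j * var i - scalar (c i j) * var i * var j - d i j | i j. i < j}"
    and cd: "\<forall>i j. i < j \<longrightarrow> c i j \<noteq> 0 \<and> d i j \<in> std_polys \<and>
        (d i j = 0 \<or>
         lexp prec (d i j) \<prec> Poly_Mapping.single i 1 + Poly_Mapping.single j 1)"
    and red: "\<forall>p. \<exists>q\<in>std_polys. (reduction c d)\<^sup>*\<^sup>* p q"
    using assms(1) unfolding commutation_system_def by auto
  have rel: "var j * var i - scalar (c i j) * var i * var j - d i j \<in> J" if "i < j" for i j
    using that \<open>S \<subseteq> J\<close> unfolding S by blast
  have c: "c i j \<noteq> 0" if "i < j" for i j
    using cd that by blast
  have d: "d i j \<in> degrees_in (below (Poly_Mapping.single i 1 + Poly_Mapping.single j 1))"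
    if "i < j" for i j
    using cd that by (intro std_polys_below_degrees_in) auto
  obtain q where "q \<in> std_polys" and pq: "(reduction c d)\<^sup>*\<^sup>* p q"
    using red by blast
  moreover have "p - q \<in> J"
    using pq
  proof induction
    case base
    show ?case using free_ideal_zero[OF J] by simp
  next
    case (step y z)
    then show ?case
      using free_ideal_diff_trans[OF J] reduction_congruent[OF J _ rel] by blast
  qed
  moreover have "q \<in> degrees_in D"
    if "\<And>\<alpha> \<beta>. \<alpha> \<prec> \<beta> \<Longrightarrow> \<beta> \<in> D \<Longrightarrow> \<alpha> \<in> D" "p \<in> degrees_in D" for D
    using pq that(2)
  proof induction
    case (step y z)
    show ?case
      by (rule reduction_degrees_in[OF step.hyps(2) c d, of D]) (use step that(1) in blast)+
  qed
  moreover have "has_lead \<delta> q" if "has_lead \<delta> p" for \<delta>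
    using pq that
  proof induction
    case (step y z)
    then show ?case
      using reduction_has_lead[of c d y z, OF step.hyps(2) c d] by blast
  qed
  ultimately show thesis
    using that by blast
qed

end


section \<open>Normal forms\<close>

locale pbw_reduction_datum =
  fixes S I :: "('n::{finite,linorder}, 'k::field) free_alg set"
    and prec :: "'n expo \<Rightarrow> 'n expo \<Rightarrow> bool" (infix \<open>\<prec>\<close> 50)
  assumes datum: "pbw_datum S I prec"

sublocale pbw_reduction_datum \<subseteq> monomial_order
  using datum by unfold_locales (simp add: pbw_datum_def commutation_system_def)

context pbw_reduction_datum
begin

abbreviation J where "J \<equiv> relations_ideal S I"

lemma commutation: "commutation_system S prec"
  and finite_I: "finite I" and I_std: "I \<subseteq> std_polys"
  and well_ordering: "well_ordering prec"
  and Lexps_I: "Lexps prec I = lexps prec (J \<inter> std_polys)"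
  using datum by (auto simp: pbw_datum_def)

lemma has_lead_in_Lexps:
  "h \<in> J \<Longrightarrow> h \<in> std_polys \<Longrightarrow> has_lead \<delta> h \<Longrightarrow> \<delta> \<in> Lexps prec I"
  unfolding Lexps_I lexps_def using has_lead_lexp_eq by blast

lemma Lexps_obtains_lead:
  assumes "\<alpha> \<in> Lexps prec I"
  obtains h where "h \<in> J" and "h \<in> std_polys" and "has_lead \<alpha> h"
  using assms unfolding Lexps_I lexps_def using has_lead_lexp by blast

definition normal_polys :: "('n, 'k) free_alg set"
  where "normal_polys = std_polys \<inter> degrees_in (- Lexps prec I)"

lemma normal_polys_iff:
  "p \<in> normal_polys \<longleftrightarrow> Poly_Mapping.keys p \<subseteq> {std_word \<alpha> | \<alpha>. \<alpha> \<notin> Lexps prec I}"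
  by (force simp: normal_polys_def std_polys_def degrees_in_def)

text \<open>The leading exponent of an element of \<open>J\<close> lies in \<open>L(I)\<close>, but no
  exponent of a normal polynomial does. This makes normal forms unique.\<close>

lemma normal_poly_in_J:
  assumes "p \<in> normal_polys" and "p \<in> J"
  shows "p = 0"
proof (rule ccontr)
  assume "p \<noteq> 0"
  then have lead: "has_lead (lexp prec p) p"
    using assms(1) has_lead_lexp by (auto simp: normal_polys_def)
  then have "lexp prec p \<in> - Lexps prec I"
    by (rule has_lead_degree_mem) (use assms(1) in \<open>simp add: normal_polys_def\<close>)
  then show False
    using has_lead_in_Lexps[OF assms(2) _ lead] assms(1) by (auto simp: normal_polys_def)
qed

text \<open>The term at \<open>\<alpha>\<close> can be disposed of: if \<open>\<alpha>\<close> is in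
  \<open>L(I)\<close>, by subtracting a multiple of an element of \<open>J\<close> with leading exponent
  \<open>\<alpha>\<close>; otherwise by moving it into the normal form.\<close>

lemma normal_form_exists_bounded:
  "p \<in> std_polys \<Longrightarrow> p \<in> degrees_in {\<beta>. preceq prec \<beta> \<alpha>} \<Longrightarrow> \<exists>r\<in>normal_polys. p - r \<in> J"
proof (induction \<alpha> arbitrary: p rule: wfp_induct_rule[OF wfp_prec[OF well_ordering]])
  case (1 \<alpha>)
  have J: "ideal J free_ring"
    by (rule ideal_relations_ideal)
  have smaller: "\<exists>r\<in>normal_polys. q - r \<in> J"
    if q: "q \<in> std_polys" "q \<in> degrees_in (below \<alpha>)" for q
  proof (cases "q = 0")
    case True
    then show ?thesis
      using free_ideal_zero[OF J]
      by (intro bexI[of _ 0]) (auto simp: normal_polys_def std_polys_zero)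
  next
    case False
    then have lead: "has_lead (lexp prec q) q"
      using q has_lead_lexp by blast
    then have "lexp prec q \<prec> \<alpha>"
      using has_lead_degree_mem[OF _ q(2)] by blast
    then show ?thesis
      using "1.IH" q(1) has_lead_degrees_in[OF lead] by blast
  qed
  show ?case
  proof (cases "\<alpha> \<in> Lexps prec I")
    case True
    then obtain h where h: "h \<in> J" "h \<in> std_polys" "has_lead \<alpha> h"
      by (rule Lexps_obtains_lead)
    obtain a where "p - scalar a * h \<in> degrees_in (below \<alpha>)"
      using cancel_lead[OF "1.prems"(1) h(2) "1.prems"(2) h(3)] .
    moreover have "p - scalar a * h \<in> std_polys"
      by (intro std_polys_diff std_polys_scalar_mult "1.prems" h)
    ultimately obtain r where r: "r \<in> normal_polys" "p - scalar a * h - r \<in> J"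
      using smaller by blast
    have "p - r = (p - scalar a * h - r) + scalar a * h"
      by simp
    then have "p - r \<in> J"
      using free_ideal_add[OF J r(2) free_ideal_mult_left[OF J h(1)]] by metis
    with r(1) show ?thesis by blast
  next
    case False
    \<comment> \<open>The monomial at \<open>\<alpha>\<close> takes the place of \<open>h\<close>; it is put back at the end.\<close>
    let ?t = "Poly_Mapping.single (std_word \<alpha>) (1 :: 'k)"
    have t: "?t \<in> std_polys"
      by (auto simp: std_polys_def)
    have "has_lead \<alpha> ?t"
      by (rule has_leadI[of _ "std_word \<alpha>" 1 0]) auto
    then obtain a where "p - scalar a * ?t \<in> degrees_in (below \<alpha>)"
      using cancel_lead[OF "1.prems"(1) t "1.prems"(2)] by blast
    moreover have "p - scalar a * ?t \<in> std_polys"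
      by (intro std_polys_diff std_polys_scalar_mult "1.prems" t)
    ultimately obtain r where r: "r \<in> normal_polys" "p - scalar a * ?t - r \<in> J"
      using smaller by blast
    have "r + scalar a * ?t \<in> normal_polys"
      using r(1) std_polys_scalar_mult[OF t] False
      by (auto simp: normal_polys_def scalar_def mult_single
          intro!: std_polys_add degrees_in_add degrees_in_single)
    moreover have "p - (r + scalar a * ?t) \<in> J"
      using r(2) by (simp add: algebra_simps)
    ultimately show ?thesis by blast
  qed
qed

lemma normal_form_exists: "\<exists>r\<in>normal_polys. p - r \<in> J"
proof -
  have J: "ideal J free_ring"
    by (rule ideal_relations_ideal)
  obtain q where q: "q \<in> std_polys" "p - q \<in> J"
    using straighten[OF commutation J relations_ideal_superset(1)] by metis
  obtain r where r: "r \<in> normal_polys" "q - r \<in> J"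
  proof (cases "q = 0")
    case True
    then show thesis
      using that[of 0] free_ideal_zero[OF J] by (simp add: normal_polys_def std_polys_zero)
  next
    case False
    then show thesis
      using that normal_form_exists_bounded[OF q(1)] has_lead_degrees_in has_lead_lexp[OF q(1)]
      by blast
  qed
  then show ?thesis
    using free_ideal_diff_trans[OF J q(2)] by blast
qed

lemma nf_coset:
  defines "a p \<equiv> J +>\<^bsub>free_ring\<^esub> p"
  shows "nf I prec (a p) \<in> normal_polys" and "p - nf I prec (a p) \<in> J"
proof -
  have J: "ideal J free_ring"
    by (rule ideal_relations_ideal)
  have "\<exists>!r. r \<in> a p \<and> r \<in> normal_polys"
  proof -
    obtain r where r: "r \<in> normal_polys" "p - r \<in> J"
      using normal_form_exists by blast
    then have "r \<in> a p"
      unfolding a_def mem_free_coset[OF J] using free_ideal_minus_commute[OF J] by blast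
    moreover have "s = r" if s: "s \<in> a p" "s \<in> normal_polys" for s
    proof -
      have "s - r \<in> J"
        using s(1) free_ideal_diff_trans[OF J _ r(2)] by (simp add: a_def mem_free_coset[OF J])
      moreover have "s - r \<in> normal_polys"
        using r(1) s(2) by (auto simp: normal_polys_def intro: std_polys_diff degrees_in_diff)
      ultimately show ?thesis
        using normal_poly_in_J by force
    qed
    ultimately show ?thesis
      using r(1) by blast
  qed
  then have "nf I prec (a p) \<in> a p \<and> nf I prec (a p) \<in> normal_polys"
    unfolding nf_def normal_polys_iff[symmetric] by (rule theI')
  then show "nf I prec (a p) \<in> normal_polys" and "p - nf I prec (a p) \<in> J"
    using free_ideal_minus_commute[OF J] by (auto simp: a_def mem_free_coset[OF J])
qed

end


section \<open>Left Groebner bases of two-sided ideals\<close>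

lemma Lexps_mono:
  assumes "F \<subseteq> H"
  shows "Lexps prec F \<subseteq> Lexps prec H"
proof
  fix \<delta>
  assume "\<delta> \<in> Lexps prec F"
  then obtain \<alpha> \<gamma> where "\<delta> = \<alpha> + \<gamma>" and "\<alpha> \<in> lexps prec F"
    unfolding Lexps_def by blast
  moreover have "lexps prec F \<subseteq> lexps prec H"
    using assms unfolding lexps_def by blast
  ultimately show "\<delta> \<in> Lexps prec H"
    unfolding Lexps_def by blast
qed

lemma left_groebner_basis_finite_subset:
  "left_groebner_basis S I prec G M \<Longrightarrow> finite G \<and> G \<subseteq> M"
  unfolding left_groebner_basis_def by (elim conjE) (intro conjI)

lemma left_groebner_basis_representation:
  fixes S I :: "('n::{finite,linorder}, 'k::field) free_alg set"
  defines "A \<equiv> pbw_algebra S I"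
  assumes "left_groebner_basis S I prec G M" and "m \<in> M"
  obtains a where "a \<in> G \<rightarrow> carrier A"
    and "m = (\<Oplus>\<^bsub>A\<^esub>g\<in>G. a g \<otimes>\<^bsub>A\<^esub> g)"
    and "\<And>g. g \<in> G \<Longrightarrow> expo_preceq prec
      (expo_plus (le_alg I prec (a g)) (le_alg I prec g)) (le_alg I prec m)"
proof -
  have "\<forall>m\<in>M. \<exists>a. a \<in> G \<rightarrow> carrier A \<and> m = (\<Oplus>\<^bsub>A\<^esub>g\<in>G. a g \<otimes>\<^bsub>A\<^esub> g) \<and>
      (\<forall>g\<in>G. expo_preceq prec
        (expo_plus (le_alg I prec (a g)) (le_alg I prec g)) (le_alg I prec m))"
    using assms(2) unfolding left_groebner_basis_def A_def by (elim conjE)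
  from bspec[OF this assms(3)] show thesis
    by (elim exE conjE) (rule that, assumption, assumption, erule bspec)
qed

text \<open>The set of leading exponents of an ideal containing the commutation relations is closed under
  adding any \<open>\<gamma>\<close>: straighten the product with the standard monomial of exponent
  \<open>\<gamma>\<close>.\<close>

lemma (in monomial_order) Lexps_subset_lexps:
  fixes F :: "('n, 'k::field) free_alg set"
  assumes S: "commutation_system S prec" and K: "ideal K free_ring" "S \<subseteq> K" "F \<subseteq> K"
    and std: "F \<subseteq> std_polys"
  shows "Lexps prec F \<subseteq> lexps prec (K \<inter> std_polys)"
proof
  fix \<delta>
  assume "\<delta> \<in> Lexps prec F"
  then obtain f \<gamma> where f: "f \<in> F" "f \<noteq> 0" and \<delta>: "\<delta> = lexp prec f + \<gamma>"
    by (auto simp: Lexps_def lexps_def)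
  have "has_lead (lexp prec f) f"
    using f std has_lead_lexp by blast
  then have lead: "has_lead \<delta> (mon (std_word \<gamma>) * f)"
    using has_lead_mult_left[of _ f "std_word \<gamma>"] by (simp add: \<delta> add.commute[of _ \<gamma>])
  obtain q where q: "q \<in> std_polys" "mon (std_word \<gamma>) * f - q \<in> K" "has_lead \<delta> q"
    using straighten[OF S K(1,2)] lead by metis
  have "mon (std_word \<gamma>) * f \<in> K"
    using free_ideal_mult_left[OF K(1)] f K(3) by blast
  then have "q \<in> K"
    using free_ideal_diff[OF K(1) _ q(2)] by fastforce
  then show "\<delta> \<in> lexps prec (K \<inter> std_polys)"
    unfolding lexps_def using has_lead_lexp_eq[OF q(1,3)] q(1) by blast
qed

context pbw_reduction_datum
begin

abbreviation coset :: "('n, 'k) free_alg \<Rightarrow> ('n, 'k) free_alg set"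
  where "coset p \<equiv> J +>\<^bsub>free_ring\<^esub> p"

abbreviation A where "A \<equiv> pbw_algebra S I"

lemma coset_hom: "ring_hom_ring free_ring A coset"
  unfolding pbw_algebra_def by (rule ideal.rcos_ring_hom_ring[OF ideal_relations_ideal])

lemma coset_mult: "coset p \<otimes>\<^bsub>A\<^esub> coset q = coset (p * q)"
  using ring_hom_mult[OF ring_hom_ring.homh[OF coset_hom], of p q] by simp

lemma coset_add: "coset p \<oplus>\<^bsub>A\<^esub> coset q = coset (p + q)"
  using ring_hom_add[OF ring_hom_ring.homh[OF coset_hom], of p q] by simp

lemma carrier_A: "carrier A = range coset"
  by (auto simp: pbw_algebra_def FactRing_def A_RCOSETS_def')

lemma coset_nf:
  assumes "a \<in> carrier A"
  shows "coset (nf I prec a) = a"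
proof -
  obtain p where a: "a = coset p"
    using assms carrier_A by blast
  have "coset p = coset (nf I prec (coset p))"
    using nf_coset(2) by (simp only: free_coset_eq_iff[OF ideal_relations_ideal])
  then show ?thesis
    by (simp only: a)
qed

lemma nf_normal: "a \<in> carrier A \<Longrightarrow> nf I prec a \<in> normal_polys"
  using nf_coset(1) by (auto simp: carrier_A)

lemma finsum_coset:
  assumes "finite H" and "H \<subseteq> carrier A" and "a \<in> H \<rightarrow> carrier A"
  shows "(\<Oplus>\<^bsub>A\<^esub>g\<in>H. a g \<otimes>\<^bsub>A\<^esub> g) = coset (\<Sum>g\<in>H. nf I prec (a g) * nf I prec g)"
proof -
  interpret A: ring A
    using ring_hom_ring.axioms(2)[OF coset_hom] .
  show ?thesis
    using assms
  proof (induction H)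
    case empty
    have "\<zero>\<^bsub>A\<^esub> = coset 0"
      using ring_hom_zero[OF ring_hom_ring.homh[OF coset_hom] ring_free_ring A.ring_axioms] by simp
    then show ?case by simp
  next
    case (insert g H)
    then have "(\<Oplus>\<^bsub>A\<^esub>g\<in>insert g H. a g \<otimes>\<^bsub>A\<^esub> g)
        = a g \<otimes>\<^bsub>A\<^esub> g \<oplus>\<^bsub>A\<^esub> (\<Oplus>\<^bsub>A\<^esub>g\<in>H. a g \<otimes>\<^bsub>A\<^esub> g)"
      by (intro A.finsum_insert) auto
    also have "(\<Oplus>\<^bsub>A\<^esub>g\<in>H. a g \<otimes>\<^bsub>A\<^esub> g) = coset (\<Sum>g\<in>H. nf I prec (a g) * nf I prec g)"
      using insert by auto
    also have "a g \<otimes>\<^bsub>A\<^esub> g = coset (nf I prec (a g) * nf I prec g)"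
      using insert by (simp add: coset_mult[symmetric] coset_nf)
    finally show ?case
      using insert by (simp add: coset_add)
  qed
qed

text \<open>If the leading exponents of \<open>f\<close> and of its normal form differed, the larger one would
  be the leading exponent of their difference, an element of \<open>J\<close>. But neither of the two lies in
  \<open>L(I)\<close>.\<close>

lemma lexp_nf_eq:
  assumes "f \<in> std_polys" and "f \<noteq> 0" and "lexp prec f \<notin> Lexps prec I"
  shows "nf I prec (coset f) \<noteq> 0" and "lexp prec (nf I prec (coset f)) = lexp prec f"
proof -
  let ?p = "nf I prec (coset f)"
  have p: "?p \<in> std_polys" "?p \<in> degrees_in (- Lexps prec I)" and diff: "f - ?p \<in> J"
    using nf_coset[of f] by (auto simp: normal_polys_def)
  have "\<not> (?p = 0 \<or> lexp prec ?p \<prec> lexp prec f)"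
  proof
    assume "?p = 0 \<or> lexp prec ?p \<prec> lexp prec f"
    then have "has_lead (lexp prec f) (f - ?p)"
      using std_polys_below_degrees_in[OF p(1)] has_lead_lexp[OF assms(1,2)] has_lead_diff by blast
    then show False
      using has_lead_in_Lexps[OF diff std_polys_diff[OF assms(1) p(1)]] assms(3) by blast
  qed
  moreover have "\<not> lexp prec f \<prec> lexp prec ?p" if "?p \<noteq> 0"
  proof
    assume less: "lexp prec f \<prec> lexp prec ?p"
    have lead: "has_lead (lexp prec ?p) ?p"
      using has_lead_lexp[OF p(1) that] .
    then have "has_lead (lexp prec ?p) (?p - f)"
      using std_polys_below_degrees_in[OF assms(1)] less has_lead_diff by blast
    moreover have "?p - f \<in> J"
      using free_ideal_minus_commute[OF ideal_relations_ideal diff] .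
    ultimately have "lexp prec ?p \<in> Lexps prec I"
      using has_lead_in_Lexps std_polys_diff[OF p(1) assms(1)] by blast
    then show False
      using has_lead_degree_mem[OF lead p(2)] by blast
  qed
  ultimately show "?p \<noteq> 0" and "lexp prec ?p = lexp prec f"
    using total by blast+
qed

text \<open>Every element of \<open>M\<close> is a combination of elements of \<open>G\<close> with
  coefficients on the left; lifting the combination to normal forms shows that its representatives lie in the
  ideal generated by \<open>S\<close>, \<open>I\<close> and the normal forms of \<open>G\<close>. The other
  inclusion uses that \<open>M\<close> is two-sided.\<close>

lemma preimage_eq_relations_ideal:
  assumes M: "ideal M A" and G: "left_groebner_basis S I prec G M"
  shows "{p. coset p \<in> M} = relations_ideal S (I \<union> nf I prec ` G)"
proof
  let ?K = "relations_ideal S (I \<union> nf I prec ` G)"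
  have carr: "m \<in> carrier A" if "m \<in> M" for m
    using ideal.Icarr[OF M that] .
  have fin: "finite G" and GM: "G \<subseteq> M"
    using left_groebner_basis_finite_subset[OF G] by simp_all
  then have GA: "G \<subseteq> carrier A"
    using carr by blast
  have K: "ideal ?K free_ring"
    by (rule ideal_relations_ideal)
  have K_sup: "S \<subseteq> ?K" "I \<subseteq> ?K" "nf I prec ` G \<subseteq> ?K"
    using relations_ideal_superset[where S = S and I = "I \<union> nf I prec ` G"] by auto
  have JK: "J \<subseteq> ?K"
    using K K_sup by (intro relations_ideal_minimal)
  show "?K \<subseteq> {p. coset p \<in> M}"
  proof (rule relations_ideal_minimal)
    show "ideal {p. coset p \<in> M} free_ring"
      using ring_hom_ring.ideal_vimage[OF coset_hom M] by simp
    have "coset p \<in> M" if "p \<in> J" for p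
    proof -
      have "coset p = \<zero>\<^bsub>A\<^esub>"
        using ring.a_rcos_zero[OF ring_free_ring ideal_relations_ideal that]
        by (simp add: pbw_algebra_def FactRing_def)
      then show ?thesis
        using additive_subgroup.zero_closed[OF ideal.axioms(1)[OF M]] by simp
    qed
    then show "S \<subseteq> {p. coset p \<in> M}" "I \<union> nf I prec ` G \<subseteq> {p. coset p \<in> M}"
      using relations_ideal_superset[where S = S and I = I] GM
      by (auto simp only: coset_nf[OF carr] subset_iff image_iff Un_iff mem_Collect_eq)
  qed
  show "{p. coset p \<in> M} \<subseteq> ?K"
  proof
    fix p
    assume "p \<in> {p. coset p \<in> M}"
    then have "coset p \<in> M"
      by simp
    then obtain a where a: "a \<in> G \<rightarrow> carrier A"
      "coset p = (\<Oplus>\<^bsub>A\<^esub>g\<in>G. a g \<otimes>\<^bsub>A\<^esub> g)"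
      by (rule left_groebner_basis_representation[OF G])
    let ?s = "\<Sum>g\<in>G. nf I prec (a g) * nf I prec g"
    have "coset p = coset ?s"
      using finsum_coset[OF fin GA a(1)] a(2) by (rule trans[rotated])
    then have "p - ?s \<in> ?K"
      using free_coset_eq_iff[OF ideal_relations_ideal] JK by blast
    moreover have "?s \<in> ?K"
    proof (rule free_ideal_sum[OF K])
      show "nf I prec (a g) * nf I prec g \<in> ?K" if "g \<in> G" for g
        by (rule free_ideal_mult_left[OF K]) (use K_sup(3) that in blast)
    qed
    ultimately show "p \<in> ?K"
      using free_ideal_add[OF K, of "p - ?s" ?s] by simp
  qed
qed

text \<open>Here the degree condition on Groebner bases enters: it is what excludes that the products cancel
  above \<open>\<alpha>\<close>, so that some product has to reach \<open>\<alpha>\<close>.\<close>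

lemma leading_exponents_of_preimage:
  assumes M: "ideal M A" and G: "left_groebner_basis S I prec G M"
  shows "lexps prec ({p. coset p \<in> M} \<inter> std_polys) \<subseteq> Lexps prec (I \<union> nf I prec ` G)"
proof
  fix \<alpha>
  assume "\<alpha> \<in> lexps prec ({p. coset p \<in> M} \<inter> std_polys)"
  then obtain f where f: "f \<in> std_polys" "f \<noteq> 0" "coset f \<in> M" and \<alpha>: "\<alpha> = lexp prec f"
    unfolding lexps_def by fast
  have fin: "finite G" and "G \<subseteq> M"
    using left_groebner_basis_finite_subset[OF G] by simp_all
  then have GA: "G \<subseteq> carrier A"
    using ideal.Icarr[OF M] by blast
  obtain a where a: "a \<in> G \<rightarrow> carrier A" "coset f = (\<Oplus>\<^bsub>A\<^esub>g\<in>G. a g \<otimes>\<^bsub>A\<^esub> g)"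
    and le: "\<And>g. g \<in> G \<Longrightarrow> expo_preceq prec
      (expo_plus (le_alg I prec (a g)) (le_alg I prec g)) (le_alg I prec (coset f))"
    by (rule left_groebner_basis_representation[OF G f(3)]) (rule that)
  let ?nf = "nf I prec"
  have mono: "Lexps prec I \<subseteq> Lexps prec (I \<union> ?nf ` G)"
    by (rule Lexps_mono) simp
  show "\<alpha> \<in> Lexps prec (I \<union> ?nf ` G)"
  proof (rule ccontr)
    assume notin: "\<alpha> \<notin> Lexps prec (I \<union> ?nf ` G)"
    have le_f: "le_alg I prec (coset f) = Some \<alpha>"
    proof -
      have "lexp prec f \<notin> Lexps prec I"
        using notin mono unfolding \<alpha> by blast
      from lexp_nf_eq[OF f(1,2) this] show ?thesis
        by (simp only: le_alg_def le0_def \<alpha> if_False)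
    qed
    \<comment> \<open>A product reaching \<open>\<alpha>\<close> would make \<open>\<alpha>\<close> divisible by the leading exponent of \<open>nf g\<close>.\<close>
    have small: "?nf (a g) * ?nf g \<in> degrees_in (below \<alpha>)" if g: "g \<in> G" for g
    proof (cases "?nf (a g) = 0 \<or> ?nf g = 0")
      case True
      then show ?thesis by auto
    next
      case False
      have std: "?nf (a g) \<in> std_polys" "?nf g \<in> std_polys"
        using g a(1) GA nf_normal by (auto simp: normal_polys_def)
      have "preceq prec (lexp prec (?nf (a g)) + lexp prec (?nf g)) \<alpha>"
        using le[OF g] False unfolding le_f by (simp add: le_alg_def le0_def)
      moreover have "lexp prec (?nf (a g)) + lexp prec (?nf g) \<noteq> \<alpha>"
      proof
        assume "lexp prec (?nf (a g)) + lexp prec (?nf g) = \<alpha>"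
        then have "\<alpha> = lexp prec (?nf g) + lexp prec (?nf (a g))"
          by (simp add: add.commute)
        moreover have "lexp prec (?nf g) \<in> lexps prec (I \<union> ?nf ` G)"
          using g False unfolding lexps_def by blast
        ultimately show False
          using notin unfolding Lexps_def by blast
      qed
      ultimately have less: "lexp prec (?nf (a g)) + lexp prec (?nf g) \<prec> \<alpha>"
        by (simp add: preceq_def)
      show ?thesis
      proof (rule degrees_in_mult)
        show "?nf (a g) \<in> degrees_in {\<beta>. preceq prec \<beta> (lexp prec (?nf (a g)))}"
          "?nf g \<in> degrees_in {\<beta>. preceq prec \<beta> (lexp prec (?nf g))}"
          using False by (simp_all add: has_lead_degrees_in has_lead_lexp std)
        show "\<beta> + \<gamma> \<in> below \<alpha>" if "\<beta> \<in> {\<beta>. preceq prec \<beta> (lexp prec (?nf (a g)))}"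
          "\<gamma> \<in> {\<beta>. preceq prec \<beta> (lexp prec (?nf g))}" for \<beta> \<gamma>
        proof -
          have "preceq prec (\<beta> + \<gamma>) (lexp prec (?nf (a g)) + lexp prec (?nf g))"
            using that by (simp only: preceq_add mem_Collect_eq)
          then show ?thesis
            using less preceq_prec_trans by blast
        qed
      qed
    qed
    let ?s = "\<Sum>g\<in>G. ?nf (a g) * ?nf g"
    have J: "ideal J free_ring"
      by (rule ideal_relations_ideal)
    have s: "?s \<in> degrees_in (below \<alpha>)"
      by (rule degrees_in_sum[OF small])
    obtain t where t: "t \<in> std_polys" "?s - t \<in> J" "t \<in> degrees_in (below \<alpha>)"
    proof (rule straighten[OF commutation J relations_ideal_superset(1), of ?s])
      fix t
      assume t: "t \<in> std_polys" "?s - t \<in> J"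
        and D: "\<And>D. (\<And>\<alpha> \<beta>. \<alpha> \<prec> \<beta> \<Longrightarrow> \<beta> \<in> D \<Longrightarrow> \<alpha> \<in> D) \<Longrightarrow> ?s \<in> degrees_in D \<Longrightarrow> t \<in> degrees_in D"
      have "t \<in> degrees_in (below \<alpha>)"
        using s prec_trans by (intro D) blast+
      with t show thesis
        by (rule that)
    qed
    have "coset f = coset ?s"
      using finsum_coset[OF fin GA a(1)] a(2) by simp
    then have "f - t \<in> J"
      by (intro free_ideal_diff_trans[OF J _ t(2)]) (simp only: free_coset_eq_iff[OF J])
    moreover have "has_lead \<alpha> (f - t)"
      using has_lead_diff[OF has_lead_lexp[OF f(1,2)]] t(3) unfolding \<alpha> by blast
    ultimately have "\<alpha> \<in> Lexps prec I"
      by (rule has_lead_in_Lexps[OF _ std_polys_diff[OF f(1) t(1)]])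
    with mono have "\<alpha> \<in> Lexps prec (I \<union> ?nf ` G)"
      by (rule subsetD)
    with notin show False
      by (rule notE)
  qed
qed

end

section \<open>The quotient algebra\<close>

text \<open>The isomorphism theorem read backwards, with the values of the isomorphism made explicit.\<close>

lemma (in ring_hom_ring) iso_onto_quotient_by_kernel:
  assumes "h ` carrier R = carrier S"
  obtains \<phi> where "\<phi> \<in> ring_iso S (R Quot a_kernel R S h)"
    and "\<And>x. x \<in> carrier R \<Longrightarrow> \<phi> (h x) = a_kernel R S h +> x"
proof
  let ?Q = "R Quot a_kernel R S h"
  let ?\<psi> = "\<lambda>Y. the_elem (h ` Y)"
  have Q: "ring ?Q"
    by (rule ideal.quotient_is_ring[OF kernel_is_ideal])
  have \<psi>: "?\<psi> \<in> ring_iso ?Q S"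
    using assms by (rule FactRing_iso_set)
  show "inv_into (carrier ?Q) ?\<psi> \<in> ring_iso S ?Q"
    by (rule ring_iso_set_sym[OF Q \<psi>])
  fix x
  assume x: "x \<in> carrier R"
  have "inj_on ?\<psi> (carrier ?Q)"
    using ring_iso_memE(5)[OF \<psi>] by (rule bij_betw_imp_inj_on)
  moreover have "a_kernel R S h +> x \<in> carrier ?Q"
    using x by (auto simp: FactRing_def A_RCOSETS_def')
  ultimately have "inv_into (carrier ?Q) ?\<psi> (?\<psi> (a_kernel R S h +> x)) = a_kernel R S h +> x"
    by (rule inv_into_f_f)
  then show "inv_into (carrier ?Q) ?\<psi> (h x) = a_kernel R S h +> x"
    using x by simp
qed

theorem corollary1p35:
  fixes S I :: "('n::{finite,linorder}, 'k::field) free_alg set"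
    and prec :: "'n expo \<Rightarrow> 'n expo \<Rightarrow> bool"
    and M G :: "('n, 'k) free_alg set set"
  assumes "pbw_datum S I prec"
    and "ideal M (pbw_algebra S I)"
    and "left_groebner_basis S I prec G M"
  shows "pbw_datum S (I \<union> nf I prec ` G) prec \<and>
    (\<exists>\<phi> \<in> ring_iso (pbw_algebra S I Quot M) (pbw_algebra S (I \<union> nf I prec ` G)).
      \<forall>p. \<phi> (M +>\<^bsub>pbw_algebra S I\<^esub> (relations_ideal S I +>\<^bsub>free_ring\<^esub> p)) =
        relations_ideal S (I \<union> nf I prec ` G) +>\<^bsub>free_ring\<^esub> p)"
proof
  interpret pbw_reduction_datum S I prec
    using assms(1) by unfold_locales
  let ?I' = "I \<union> nf I prec ` G"
  have fin: "finite G" and "G \<subseteq> M"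
    using left_groebner_basis_finite_subset[OF assms(3)] by simp_all
  then have GA: "G \<subseteq> carrier A"
    using ideal.Icarr[OF assms(2)] by blast
  have preimage: "{p. coset p \<in> M} = relations_ideal S ?I'"
    by (rule preimage_eq_relations_ideal[OF assms(2,3)])
  have std: "?I' \<subseteq> std_polys"
    using I_std GA nf_normal by (auto simp: normal_polys_def)
  have "Lexps prec ?I' = lexps prec (relations_ideal S ?I' \<inter> std_polys)"
  proof
    show "Lexps prec ?I' \<subseteq> lexps prec (relations_ideal S ?I' \<inter> std_polys)"
      using Lexps_subset_lexps[OF commutation ideal_relations_ideal relations_ideal_superset std] .
    show "lexps prec (relations_ideal S ?I' \<inter> std_polys) \<subseteq> Lexps prec ?I'"
      using leading_exponents_of_preimage[OF assms(2,3)] by (simp add: preimage)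
  qed
  then show "pbw_datum S ?I' prec"
    using std commutation well_ordering finite_I fin by (simp add: pbw_datum_def)

  let ?B = "A Quot M"
  let ?h = "\<lambda>p. M +>\<^bsub>A\<^esub> coset p"
  have projM: "ring_hom_ring A ?B ((+>\<^bsub>A\<^esub>) M)"
    by (rule ideal.rcos_ring_hom_ring[OF assms(2)])
  have "(+>\<^bsub>A\<^esub>) M \<circ> coset \<in> ring_hom free_ring ?B"
    by (rule ring_hom_trans[OF ring_hom_ring.homh[OF coset_hom] ring_hom_ring.homh[OF projM]])
  then have hom: "ring_hom_ring free_ring ?B ?h"
    using ring_hom_ring.axioms(2)[OF projM] by (intro ring_hom_ringI2 ring_free_ring) (simp_all add: comp_def)
  have kernel: "a_kernel free_ring ?B ?h = relations_ideal S ?I'"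
  proof -
    have "M +>\<^bsub>A\<^esub> coset p = M \<longleftrightarrow> coset p \<in> M" for p
      using ideal.rcos_const_imp_mem[OF assms(2), of "coset p"] carrier_A
        ring.a_rcos_zero[OF ring_hom_ring.axioms(2)[OF coset_hom] assms(2)] by auto
    moreover have "\<zero>\<^bsub>?B\<^esub> = M"
      by (simp add: FactRing_def)
    ultimately show ?thesis
      unfolding a_kernel_def' preimage[symmetric] by simp
  qed
  have "?h ` carrier free_ring = carrier ?B"
    by (auto simp: FactRing_def A_RCOSETS_def' carrier_A)
  then obtain \<phi> where "\<phi> \<in> ring_iso ?B (free_ring Quot a_kernel free_ring ?B ?h)"
    and "\<And>p. p \<in> carrier free_ring \<Longrightarrow> \<phi> (?h p) = a_kernel free_ring ?B ?h +>\<^bsub>free_ring\<^esub> p"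
    using ring_hom_ring.iso_onto_quotient_by_kernel[OF hom] by blast
  then show "\<exists>\<phi> \<in> ring_iso ?B (pbw_algebra S ?I').
      \<forall>p. \<phi> (?h p) = relations_ideal S ?I' +>\<^bsub>free_ring\<^esub> p"
    unfolding kernel by (auto simp: pbw_algebra_def[of S ?I'])
qed

end
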